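(* Let $\mathscr{A}=\{a_1,\ldots,a_n\}\subset\mathbb{Z}$ be a finite set with $0<a_1<\cdots<a_n$, $\gcd(a_1,\ldots,a_n)=1$ and $1<a_1$. If $a_1$ and $a_2$ have $k_1$ and $k_2$ digits (in base $10$), respectively, then $\delta(\mathscr{A})<\min\{5k_1,\,5k_2-1\}$.
   Context: For a finite set $\mathscr{A}=\{a_1,\ldots,a_n\}$ of integers with $0<a_1<\cdots<a_n$ and gcd $1$, put $\mathscr{A}':=\{a_1\}\cup\{a_2-a_1,\ldots,a_n-a_1\}$ (a set of positive integers with gcd $1$, reordered increasingly), $\mathscr{A}^1:=\mathscr{A}'$, and $\mathscr{A}^k:=(\mathscr{A}^{k-1})'$ for $k\geq2$. The algorithm iterates $\mathscr{A}\mapsto\mathscr{A}'$ until the set contains $1$. Number of division algorithms $\delta(\mathscr{A})$ (for $a_1>1$): the iteration is grouped into division algorithms as follows. Start with $\mathscr{B}:=\mathscr{A}$. While $\min(\mathscr{B})>1$: first discard from $\mathscr{B}$ all multiples of $\min(\mathscr{B})$ other than $\min(\mathscr{B})$ itself; let $b_1<b_2$ be the two smallest elements of the resulting set $\mathscr{B}$ (it has at least two elements since its gcd is $1$ and $b_1>1$); perform the division $b_2=b_1q+r$ with $0<r<b_1$; then replace $\mathscr{B}$ by $\mathscr{B}^q$, whose minimum is $r$. Each pass through this loop counts as one division algorithm, and $\delta(\mathscr{A})$ is the total number of passes until $1$ belongs to the set. *)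

theory Defs
  imports Complex_Main "HOL-Library.While_Combinator"
begin

text \<open>The set \<open>\<A>'\<close>; its iterate \<open>\<A>\<^sup>k\<close> is \<open>(derived_set ^^ k) \<A>\<close>.\<close>

definition derived_set :: "int set \<Rightarrow> int set" where
  "derived_set A = {Min A} \<union> (\<lambda>x. x - Min A) ` (A - {Min A})"

definition discard_multiples :: "int set \<Rightarrow> int set" where
  "discard_multiples B = B - {x \<in> B. Min B dvd x \<and> x \<noteq> Min B}"

definition second_Min :: "int set \<Rightarrow> int" where
  "second_Min B = Min (B - {Min B})"

definition division_algorithm :: "int set \<Rightarrow> int set" where
  "division_algorithm B =
    (let C = discard_multiples B;
         b1 = Min C;
         b2 = second_Min C;
         q = b2 div b1
     in (derived_set ^^ nat q) C)"

text \<open>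
  The second component of the loop state counts the passes. The value is unspecified when the
  loop does not terminate; it does terminate on every finite set of positive integers with gcd 1,
  because a pass keeps these properties and replaces the minimum \<open>b1\<close> by
  \<open>r = b2 mod b1 < b1\<close>, where \<open>r > 0\<close>.
\<close>

definition num_division_algorithms :: "int set \<Rightarrow> nat" where
  "num_division_algorithms A =
    snd (while (\<lambda>(B, c). Min B > 1) (\<lambda>(B, c). (division_algorithm B, Suc c)) (A, 0))"

text \<open>The digits are listed with the least significant one first, hence the leading digit is
  the last element.\<close>

definition has_decimal_digits :: "int \<Rightarrow> nat \<Rightarrow> bool" where
  "has_decimal_digits a k \<longleftrightarrow>
    (\<exists>ds :: nat list. ds \<noteq> [] \<and> length ds = k \<and> (\<forall>d \<in> set ds. d < 10) \<and> last ds \<noteq> 0 \<and>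
       a = horner_sum int 10 ds)"

end

theory Submission
  imports Defs "HOL-Number_Theory.Fib"
begin

text \<open>
  The argument is Lame's, transported from pairs to sets. A pass with minimum \<open>b\<close> produces a
  set that still contains \<open>b\<close> and whose minimum is a proper remainder \<open>r < b\<close>. The inequality that
  drives everything is \<open>add_Min_division_algorithm_le\<close>: every element of the set other than the
  minimum is at least \<open>b + r\<close>. Applied to the set after a pass, with the old minimum as
  the element, it says that three consecutive minima satisfy \<open>b \<ge> r + r'\<close>, even when the
  old minimum is itself discarded as a multiple of \<open>r\<close>. Applied to the initial set, with \<open>a\<^sub>2\<close> as
  the element, it gives one further Fibonacci step.

  Hence the minima, read backwards from the final \<open>1\<close>, dominate the Fibonacci numbers: if
  \<open>\<delta>\<close> passes are made, then the minimum is at least \<open>F\<^bsub>\<delta>+2\<^esub>\<close> and every other element at least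
  \<open>F\<^bsub>\<delta>+3\<^esub>\<close> (\<open>fib_num_division_algorithms_le\<close>). Fibonacci numbers gain a decimal
  digit at least every five indices, \<open>10\<^sup>k \<le> F\<^bsub>5k+2\<^esub>\<close>, so \<open>a\<^sub>1 < 10\<^bsup>k\<^sub>1\<^esup>\<close> forces
  \<open>\<delta> < 5 k\<^sub>1\<close>, and \<open>a\<^sub>2 < 10\<^bsup>k\<^sub>2\<^esup>\<close> forces \<open>\<delta> + 1 < 5 k\<^sub>2\<close>.
\<close>

section \<open>Finite sets of positive integers with gcd 1\<close>

definition primitive :: "int set \<Rightarrow> bool" where
  "primitive B \<longleftrightarrow> finite B \<and> (\<forall>x\<in>B. 0 < x) \<and> Gcd B = 1"

lemma primitive_nonempty: "primitive B \<Longrightarrow> B \<noteq> {}"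
  by (auto simp: primitive_def)

lemma primitive_Min_in: "primitive B \<Longrightarrow> Min B \<in> B"
  using Min_in primitive_nonempty by (auto simp: primitive_def)

lemma primitive_Min_pos: "primitive B \<Longrightarrow> 0 < Min B"
  using primitive_Min_in by (auto simp: primitive_def)

lemma primitive_exists_non_multiple:
  assumes "primitive B" and "1 < Min B"
  obtains x where "x \<in> B" "\<not> Min B dvd x"
proof -
  have "\<not> Min B dvd Gcd B"
    using assms by (auto simp: primitive_def)
  then show ?thesis
    using that Gcd_greatest by blast
qed

section \<open>The effect of one pass\<close>

text \<open>
  If the elements other than the minimum \<open>b\<close> are still positive after \<open>k\<close> subtractions of \<open>b\<close>, then
  they exceeded \<open>b\<close> before each of these. So \<open>b\<close> is the minimum of every set to which one of the
  \<open>k\<close> steps is applied, and each step subtracts the same number.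
\<close>

lemma derived_set_funpow:
  assumes "b \<in> C"
    and "\<And>x. x \<in> C \<Longrightarrow> x \<noteq> b \<Longrightarrow> int k * b < x"
    and "finite C" and "0 \<le> b"
  shows "(derived_set ^^ k) C = insert b ((\<lambda>x. x - int k * b) ` (C - {b}))"
  using assms(2)
proof (induction k)
  case 0
  then show ?case
    using assms(1) by auto
next
  case (Suc k)
  have "b < x - int k * b" if "x \<in> C" "x \<noteq> b" for x
    using Suc.prems[OF that] by (simp add: algebra_simps)
  note above = this
  let ?D = "insert b ((\<lambda>x. x - int k * b) ` (C - {b}))"
  have min: "Min ?D = b"
    using above assms(3) by (intro Min_eqI) (auto intro: less_imp_le)
  have "int k * b < x" if "x \<in> C" "x \<noteq> b" for x
    using above[OF that] assms(4) by linarith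
  then have "(derived_set ^^ k) C = ?D"
    by (rule Suc.IH)
  moreover have "?D - {b} = (\<lambda>x. x - int k * b) ` (C - {b})"
    using above by fastforce
  moreover have "derived_set ?D = insert b ((\<lambda>x. x - b) ` (?D - {b}))"
    by (simp only: derived_set_def min) simp
  ultimately show ?case
    by (simp add: image_image algebra_simps)
qed

lemma Min_discard_multiples:
  assumes "primitive B"
  shows "Min (discard_multiples B) = Min B"
  using assms primitive_Min_in[OF assms]
  by (intro Min_eqI) (auto simp: discard_multiples_def primitive_def)

lemma discard_multiples_others: "discard_multiples B - {Min B} = {x \<in> B. \<not> Min B dvd x}"
  by (auto simp: discard_multiples_def)

lemma int_mod_pos_of_not_dvd:
  fixes b x :: int
  assumes "0 < b" and "\<not> b dvd x"
  shows "0 < x mod b"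
  using assms pos_mod_sign[of b x] by (simp add: dvd_eq_mod_eq_0 order_less_le)

lemma second_Min_discard_multiples:
  assumes "primitive B" and "1 < Min B"
  defines "b2 \<equiv> second_Min (discard_multiples B)"
  shows "b2 \<in> B" and "\<not> Min B dvd b2"
    and "\<And>x. x \<in> B \<Longrightarrow> \<not> Min B dvd x \<Longrightarrow> b2 \<le> x"
proof -
  let ?N = "{x \<in> B. \<not> Min B dvd x}"
  have b2: "b2 = Min ?N"
    using assms(1)
    by (simp add: b2_def second_Min_def Min_discard_multiples discard_multiples_others)
  have fin: "finite ?N"
    using assms(1) by (simp add: primitive_def)
  moreover have "?N \<noteq> {}"
    using primitive_exists_non_multiple[OF assms(1,2)] by blast
  ultimately have "b2 \<in> ?N"
    unfolding b2 by (rule Min_in)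
  then show "b2 \<in> B" and "\<not> Min B dvd b2"
    by auto
  show "b2 \<le> x" if "x \<in> B" "\<not> Min B dvd x" for x
    unfolding b2 using fin that by simp
qed

lemma division_algorithm_eq:
  assumes "primitive B" and "1 < Min B"
  defines "b2 \<equiv> second_Min (discard_multiples B)"
  shows "division_algorithm B =
    insert (Min B) ((\<lambda>x. x - b2 div Min B * Min B) ` {x \<in> B. \<not> Min B dvd x})"
proof -
  let ?C = "discard_multiples B" and ?b = "Min B" and ?q = "b2 div Min B"
  note b2 = second_Min_discard_multiples[OF assms(1,2), folded b2_def]
  have q: "0 \<le> ?q"
    using assms(1) b2(1) primitive_Min_pos[OF assms(1)]
    by (auto simp: primitive_def pos_imp_zdiv_nonneg_iff intro: less_imp_le)
  have others: "?C - {?b} = {x \<in> B. \<not> ?b dvd x}"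
    by (rule discard_multiples_others)
  have "?q * ?b < b2"
    using int_mod_pos_of_not_dvd[OF _ b2(2)] assms(2) div_mult_mod_eq[of b2 ?b] by linarith
  then have "int (nat ?q) * ?b < x" if "x \<in> ?C" "x \<noteq> ?b" for x
    using that others b2(3)[of x] q by force
  moreover have "?b \<in> ?C" "finite ?C"
    using assms(1) primitive_Min_in[OF assms(1)]
    by (auto simp: discard_multiples_def primitive_def)
  ultimately have "(derived_set ^^ nat ?q) ?C =
      insert ?b ((\<lambda>x. x - int (nat ?q) * ?b) ` (?C - {?b}))"
    using assms(2) by (intro derived_set_funpow) auto
  then show ?thesis
    using q assms(1)
    by (simp add: division_algorithm_def Let_def Min_discard_multiples others flip: b2_def)
qed

lemma Min_in_division_algorithm:
  assumes "primitive B" and "1 < Min B"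
  shows "Min B \<in> division_algorithm B"
  using division_algorithm_eq[OF assms] by simp

lemma Min_division_algorithm:
  assumes "primitive B" and "1 < Min B"
  shows "Min (division_algorithm B) = second_Min (discard_multiples B) mod Min B"
proof -
  note b2 = second_Min_discard_multiples[OF assms]
  show ?thesis
    unfolding division_algorithm_eq[OF assms]
  proof (rule Min_eqI, goal_cases)
    case 1
    then show ?case
      using assms(1) by (simp add: primitive_def)
  next
    case (2 y)
    then show ?case
      using b2(3) assms(2) pos_mod_bound[of "Min B" "second_Min (discard_multiples B)"]
      by (auto simp: less_imp_le simp flip: minus_div_mult_eq_mod)
  next
    case 3
    then show ?case
      using b2(1,2) by (auto simp flip: minus_div_mult_eq_mod)
  qed
qed

lemma Min_division_algorithm_bounds:
  assumes "primitive B" and "1 < Min B"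
  shows "0 < Min (division_algorithm B)" and "Min (division_algorithm B) < Min B"
  using int_mod_pos_of_not_dvd[OF _ second_Min_discard_multiples(2)[OF assms]] assms(2)
  by (simp_all add: Min_division_algorithm[OF assms])

text \<open>
  Discarding elements may in principle enlarge the gcd. It does not, because the minimum is kept and
  divides everything that is discarded.
\<close>

lemma primitive_division_algorithm:
  assumes "primitive B" and "1 < Min B"
  shows "primitive (division_algorithm B)"
proof -
  let ?D = "division_algorithm B" and ?b = "Min B"
  let ?q = "second_Min (discard_multiples B) div Min B"
  note eq = division_algorithm_eq[OF assms]
  have fin: "finite ?D"
    using assms(1) by (simp add: eq primitive_def)
  have "0 < x" if "x \<in> ?D" for x
    using Min_le[OF fin that] Min_division_algorithm_bounds(1)[OF assms] by linarith
  moreover have "Gcd ?D dvd x" if "x \<in> B" for x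
  proof -
    have b: "Gcd ?D dvd ?b"
      by (intro Gcd_dvd Min_in_division_algorithm assms)
    show ?thesis
    proof (cases "?b dvd x")
      case True
      with b show ?thesis
        by (rule dvd_trans)
    next
      case False
      then have "Gcd ?D dvd x - ?q * ?b"
        using that by (intro Gcd_dvd) (simp add: eq)
      with b show ?thesis
        by (metis dvd_add_left_iff dvd_mult diff_add_cancel)
    qed
  qed
  then have "Gcd ?D dvd Gcd B"
    by (rule Gcd_greatest)
  then have "Gcd ?D = 1"
    using assms(1) by (simp add: primitive_def)
  ultimately show ?thesis
    using fin by (simp add: primitive_def)
qed

text \<open>
  A multiple of the minimum \<open>b\<close> other than \<open>b\<close> is at least \<open>2 b\<close>, which exceeds \<open>b + r\<close>. A
  non-multiple is at least the second number \<open>b\<^sub>2 = q b + r\<close> of the division, where \<open>q \<ge> 1\<close>.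
\<close>

lemma add_Min_division_algorithm_le:
  assumes "primitive B" and "1 < Min B" and "x \<in> B" and "x \<noteq> Min B"
  shows "Min B + Min (division_algorithm B) \<le> x"
proof (cases "Min B dvd x")
  case True
  have "Min B < x"
    using assms by (metis Min_le order_le_less primitive_def)
  with True have "Min B dvd x - Min B" "0 < x - Min B"
    by auto
  then have "Min B \<le> x - Min B"
    by (rule zdvd_imp_le)
  then show ?thesis
    using Min_division_algorithm_bounds(2)[OF assms(1,2)] by linarith
next
  case False
  let ?b2 = "second_Min (discard_multiples B)"
  note b2 = second_Min_discard_multiples[OF assms(1,2)]
  have "Min B \<le> ?b2"
    using assms(1) b2(1) by (simp add: primitive_def)
  then have "1 \<le> ?b2 div Min B"
    using assms(2) by (simp add: pos_imp_zdiv_pos_iff int_one_le_iff_zero_less)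
  then have "Min B \<le> ?b2 div Min B * Min B"
    using assms(2) by simp
  then have "Min B + ?b2 mod Min B \<le> ?b2"
    using div_mult_mod_eq[of ?b2 "Min B"] by linarith
  also have "?b2 \<le> x"
    using b2(3) assms(3) False .
  finally show ?thesis
    by (simp add: Min_division_algorithm[OF assms(1,2)])
qed

section \<open>Fibonacci bounds for the number of passes\<close>

text \<open>
  Unfolding the loop once leaves a state whose counter is \<open>1\<close>, which is no longer of the form that
  defines \<^const>\<open>num_division_algorithms\<close>. Additivity in the initial counter bridges this gap.
\<close>

lemma while_division_algorithm_counter:
  assumes "primitive B"
  shows "snd (while (\<lambda>(B, c). Min B > 1) (\<lambda>(B, c). (division_algorithm B, Suc c)) (B, c)) =
    c + num_division_algorithms B"
  using assms
proof (induction "nat (Min B)" arbitrary: B c rule: less_induct)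
  case less
  show ?case
  proof (cases "1 < Min B")
    case True
    let ?D = "division_algorithm B"
    have "nat (Min ?D) < nat (Min B)"
      using Min_division_algorithm_bounds[OF less.prems True] by simp
    note IH = less.hyps[OF this primitive_division_algorithm[OF less.prems True]]
    show ?thesis
      using True
      by (subst while_unfold) (simp add: IH num_division_algorithms_def[of B] while_unfold[of _ _ "(B, 0)"])
  next
    case False
    then show ?thesis
      by (simp add: num_division_algorithms_def while_unfold)
  qed
qed

lemma num_division_algorithms_rec:
  assumes "primitive B" and "1 < Min B"
  shows "num_division_algorithms B = Suc (num_division_algorithms (division_algorithm B))"
  using assms(2)
  by (subst num_division_algorithms_def, subst while_unfold)
    (simp add: while_division_algorithm_counter primitive_division_algorithm assms)

lemma num_division_algorithms_eq_0:
  assumes "\<not> 1 < Min B"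
  shows "num_division_algorithms B = 0"
  using assms by (simp add: num_division_algorithms_def while_unfold)

text \<open>
  Both bounds are proved together: the minimum before a pass is a non-minimal element after it, so
  the second bound for the new set yields the first bound for the old one. For minimum \<open>1\<close> the
  bounds are \<open>F\<^sub>2 = 1\<close> and \<open>F\<^sub>3 = 2\<close>, so both hold from the start of the induction.
\<close>

lemma fib_num_division_algorithms_le:
  assumes "primitive B"
  shows "int (fib (num_division_algorithms B + 2)) \<le> Min B"
    and "\<And>x. x \<in> B \<Longrightarrow> x \<noteq> Min B \<Longrightarrow> int (fib (num_division_algorithms B + 3)) \<le> x"
proof -
  have "int (fib (num_division_algorithms B + 2)) \<le> Min B \<and>
      (\<forall>x \<in> B - {Min B}. int (fib (num_division_algorithms B + 3)) \<le> x)"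
    using assms
  proof (induction "nat (Min B)" arbitrary: B rule: less_induct)
    case less
    show ?case
    proof (cases "1 < Min B")
      case True
      let ?D = "division_algorithm B"
      let ?d = "num_division_algorithms ?D"
      note bounds = Min_division_algorithm_bounds[OF less.prems True]
      have "nat (Min ?D) < nat (Min B)"
        using bounds by simp
      note IH = less.hyps[OF this primitive_division_algorithm[OF less.prems True]]
      have r: "int (fib (?d + 2)) \<le> Min ?D"
        using IH by blast
      have b: "int (fib (?d + 3)) \<le> Min B"
        using IH Min_in_division_algorithm[OF less.prems True] bounds(2) by auto
      have "int (fib (?d + 4)) \<le> x" if "x \<in> B" "x \<noteq> Min B" for x
      proof -
        have "fib (?d + 4) = fib (?d + 3) + fib (?d + 2)"
          by (simp add: numeral_eq_Suc)
        then show ?thesis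
          using r b add_Min_division_algorithm_le[OF less.prems True that] by linarith
      qed
      with b show ?thesis
        using num_division_algorithms_rec[OF less.prems True]
        by (simp add: numeral_eq_Suc)
    next
      case False
      then have "Min B = 1"
        using primitive_Min_pos[OF less.prems] by linarith
      moreover have "fib 2 = 1" "fib 3 = 2"
        by (simp_all add: numeral_eq_Suc)
      moreover have "2 \<le> x" if "x \<in> B" "x \<noteq> 1" for x
        using that less.prems by (force simp: primitive_def)
      ultimately show ?thesis
        using num_division_algorithms_eq_0[OF False] by auto
    qed
  qed
  then show "int (fib (num_division_algorithms B + 2)) \<le> Min B"
    and "\<And>x. x \<in> B \<Longrightarrow> x \<noteq> Min B \<Longrightarrow> int (fib (num_division_algorithms B + 3)) \<le> x"
    by auto
qed

section \<open>Fibonacci numbers and decimal digits\<close>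

text \<open>
  For \<open>m \<ge> 2\<close> the recursion gives \<open>F\<^bsub>m+5\<^esub> = 8 F\<^bsub>m\<^esub> + 5 F\<^bsub>m-1\<^esub>\<close>, and \<open>2 F\<^bsub>m-1\<^esub> \<ge> F\<^bsub>m\<^esub>\<close>; so five
  steps multiply by more than \<open>10\<close>.
\<close>

lemma power_10_le_fib: "10 ^ k \<le> fib (5 * k + 2)"
proof (induction k)
  case 0
  show ?case
    by (simp add: numeral_eq_Suc)
next
  case (Suc k)
  have step: "10 * fib (Suc (Suc m)) \<le> fib (Suc (Suc m) + 5)" for m
    using fib_mono[of m "Suc m"] by (simp add: numeral_eq_Suc)
  have "10 * fib (5 * k + 2) \<le> fib (5 * k + 2 + 5)"
    using step[of "5 * k"] by simp
  moreover have "5 * Suc k + 2 = 5 * k + 2 + 5"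
    by simp
  ultimately show ?case
    using Suc.IH by (metis mult_le_mono2 order_trans power_Suc)
qed

lemma less_of_fib_less_power_10:
  assumes "fib (n + 2) < 10 ^ k"
  shows "n < 5 * k"
proof (rule ccontr)
  assume "\<not> n < 5 * k"
  then have "fib (5 * k + 2) \<le> fib (n + 2)"
    by (intro fib_mono) simp
  with power_10_le_fib[of k] assms show False
    by linarith
qed

lemma has_decimal_digits_less:
  assumes "has_decimal_digits a k"
  shows "a < 10 ^ k"
proof -
  have "horner_sum int 10 ds < 10 ^ length ds" if "\<forall>d \<in> set ds. d < 10" for ds :: "nat list"
    using that by (induction ds) auto
  with assms show ?thesis
    by (auto simp: has_decimal_digits_def)
qed

theorem corollary4p8:
  fixes A :: "int set" and a :: "nat \<Rightarrow> int" and n k1 k2 :: nat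
  assumes "A = a ` {1..n}"
    and "strict_mono_on {1..n} a"
    and "0 < a 1"
    and "Gcd A = 1"
    and "1 < a 1"
    and "has_decimal_digits (a 1) k1"
    and "has_decimal_digits (a 2) k2"
  shows "int (num_division_algorithms A) < min (5 * int k1) (5 * int k2 - 1)"
proof -
  let ?d = "num_division_algorithms A"
  have n: "2 \<le> n"
  proof (rule ccontr)
    assume "\<not> 2 \<le> n"
    then have "n = 0 \<or> n = 1"
      by auto
    with assms(1,4,5) show False
      by auto
  qed
  have first: "a 1 \<le> a i" if "i \<in> {1..n}" for i
    using strict_mono_on_leD[OF assms(2)] that n by auto
  have min: "Min A = a 1"
    using first n by (intro Min_eqI) (auto simp: assms(1))
  have prim: "primitive A"
    using first assms(3,4) by (fastforce simp: primitive_def assms(1))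
  have "a 2 \<in> A" "a 2 \<noteq> a 1"
    using strict_mono_onD[OF assms(2), of 1 2] n by (auto simp: assms(1))
  then have "int (fib (?d + 3)) \<le> a 2"
    using fib_num_division_algorithms_le(2)[OF prim] by (simp add: min)
  also have "a 2 < 10 ^ k2"
    using assms(7) by (rule has_decimal_digits_less)
  finally have "fib (?d + 1 + 2) < 10 ^ k2"
    by (simp add: numeral_eq_Suc flip: of_nat_less_iff[where 'a = int])
  then have k2: "?d + 1 < 5 * k2"
    by (rule less_of_fib_less_power_10)
  have "int (fib (?d + 2)) \<le> a 1"
    using fib_num_division_algorithms_le(1)[OF prim] by (simp add: min)
  also have "a 1 < 10 ^ k1"
    using assms(6) by (rule has_decimal_digits_less)
  finally have "fib (?d + 2) < 10 ^ k1"
    by (simp flip: of_nat_less_iff[where 'a = int])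
  then have "?d < 5 * k1"
    by (rule less_of_fib_less_power_10)
  with k2 show ?thesis
    by simp
qed

end
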